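(* Let $(X,T)$ be a dynamical system. The following conditions are equivalent: 1. $(X,T)$ is multi-sensitive. 2. There exists $\delta>0$ such that for any finite collection $x_1,\dots,x_k$ of points in $X$ and any system of open neighborhoods $U_i\ni x_i$ ($i=1,\dots,k$), there exist points $y_i\in U_i$ and a nonnegative integer $n$ with $\min_{1\le i\le k}d(T^nx_i,T^ny_i)>\delta$. 3. There exists $\delta>0$ such that for any finite collection $x_1,\dots,x_k$ of points in $X$ and any system of open neighborhoods $U_i\ni x_i$ ($i=1,\dots,k$), there exist points $y_i\in U_i$ with $\limsup_{n\to\infty}\min_{1\le i\le k}d(T^nx_i,T^ny_i)>\delta$. 4. There exists $\delta>0$ such that for any finite collection $U_1,\dots,U_k$ of opene subsets of $X$, there exist $x_i,y_i\in U_i$ with $\limsup_{n\to\infty}\min_{1\le i\le k}d(T^nx_i,T^ny_i)>\delta$.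
   Context: A dynamical system $(X,T)$ consists of a nonempty compact metric space $X$ (metric $d$) and a continuous surjective map $T:X\to X$; by standing assumption $X$ has no isolated points and is not a singleton. $\mathbb{Z}_+$ is the set of nonnegative integers. "Opene" means open and nonempty. For $\delta>0$ and opene $U\subset X$, $S_T(U,\delta)=\{n\in\mathbb{Z}_+:\text{there are }x_1,x_2\in U\text{ with }d(T^nx_1,T^nx_2)>\delta\}$. The system is multi-sensitive if there is $\delta>0$ such that $\bigcap_{i=1}^kS_T(U_i,\delta)\neq\varnothing$ for every finite collection of opene $U_1,\dots,U_k\subset X$. *)

theory Defs
  imports "HOL-Analysis.Analysis"
begin

text \<open>
  The space is a compact subset \<open>X\<close> of a type of class \<^class>\<open>metric_space\<close>, carrying the
  restricted metric and the subspace topology. The values of \<open>T\<close> outside \<open>X\<close> are irrelevant.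
\<close>

definition dynamical_system :: "'a::metric_space set \<Rightarrow> ('a \<Rightarrow> 'a) \<Rightarrow> bool" where
  "dynamical_system X T \<longleftrightarrow>
     X \<noteq> {} \<and> compact X \<and> continuous_on X T \<and> T ` X = X \<and>
     (\<forall>x\<in>X. x islimpt X) \<and> \<not> is_singleton X"

definition opene :: "'a::metric_space set \<Rightarrow> 'a set \<Rightarrow> bool" where
  "opene X U \<longleftrightarrow> openin (top_of_set X) U \<and> U \<noteq> {}"

definition sensitivity_times :: "('a::metric_space \<Rightarrow> 'a) \<Rightarrow> 'a set \<Rightarrow> real \<Rightarrow> nat set" where
  "sensitivity_times T U \<delta> = {n. \<exists>x1\<in>U. \<exists>x2\<in>U. dist ((T ^^ n) x1) ((T ^^ n) x2) > \<delta>}"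

text \<open>
  A finite collection \<open>U\<^sub>1, \<dots>, U\<^sub>k\<close> is a function on \<^typ>\<open>nat\<close> of which only the values at
  \<open>1, \<dots>, k\<close> matter; \<open>k \<ge> 1\<close>, and repetitions are allowed.
\<close>

definition multi_sensitive :: "'a::metric_space set \<Rightarrow> ('a \<Rightarrow> 'a) \<Rightarrow> bool" where
  "multi_sensitive X T \<longleftrightarrow>
     (\<exists>\<delta>>0. \<forall>k\<ge>1. \<forall>U. (\<forall>i\<in>{1..k}. opene X (U i)) \<longrightarrow>
        (\<Inter>i\<in>{1..k::nat}. sensitivity_times T (U i) \<delta>) \<noteq> {})"

end

theory Submission
  imports Defs
begin

text \<open>
  Multi-sensitivity produces a common time at which each set of a finite collection is stretched;
  the other conditions fix the reference points \<open>x\<^sub>i\<close> in advance, or ask for infinitely many times.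
  If two points of \<open>U\<^sub>i\<close> are more than \<open>\<delta>\<close> apart at time \<open>n\<close>, one of them is more than
  \<open>\<delta>/2\<close> away from \<open>x\<^sub>i\<close> at that time, so fixing reference points only halves the constant.

  The point of the proof is to get infinitely many common times for a single choice of the points
  \<open>y\<^sub>i\<close>. A stretching time can be forced to be late: the finitely many maps \<open>T\<^sup>0, \<dots>, T\<^sup>N\<close> are
  continuous, so after shrinking the open sets none of these maps stretches them by more than
  \<open>\<delta>\<close>, and the common time provided by multi-sensitivity exceeds \<open>N\<close> (lemma
  \<open>later_separation\<close>). Being far from the orbit of \<open>x\<^sub>i\<close> at a given time is an open condition, so
  each separation can be preserved on a smaller open set whose closure lies in the previous one.
  Iterating gives nested sequences of sets, and by compactness a point \<open>y\<^sub>i\<close> in each intersection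
  is far from \<open>x\<^sub>i\<close> along the whole sequence of times (lemma \<open>infinitely_many_separations\<close>).

  This turns multi-sensitivity into the condition with prescribed points and a limit superior,
  which for a given \<open>\<delta>\<close> implies the other three. These are read off from it, and multi-sensitivity
  from each condition, since a limit superior above \<open>\<delta>\<close> is witnessed by a single time.
\<close>

section \<open>Open sets and iterates\<close>

lemma opene_subset: "opene X U \<Longrightarrow> U \<subseteq> X"
  unfolding opene_def by (blast dest: openin_imp_subset)

lemma opene_selection:
  assumes "\<forall>i\<in>I. opene X (U i)"
  shows "\<exists>x. \<forall>i\<in>I. x i \<in> X \<and> openin (top_of_set X) (U i) \<and> x i \<in> U i"
proof -
  have "\<forall>i\<in>I. \<exists>z. z \<in> U i"
    using assms by (auto simp: opene_def)
  then obtain x where "\<forall>i\<in>I. x i \<in> U i"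
    by (rule bchoice[THEN exE])
  then show ?thesis
    using assms by (intro exI[of _ x]) (auto simp: opene_def dest: openin_imp_subset)
qed

lemma continuous_on_funpow:
  assumes "continuous_on X T" "T ` X \<subseteq> X"
  shows "continuous_on X (T ^^ n)"
proof (induction n)
  case 0
  then show ?case by (simp add: id_def)
next
  case (Suc n)
  have "continuous_on (T ` X) (T ^^ n)"
    using Suc assms(2) by (rule continuous_on_subset)
  then have "continuous_on X ((T ^^ n) \<circ> T)"
    by (rule continuous_on_compose[OF assms(1)])
  then show ?case by (simp add: funpow_Suc_right del: funpow.simps)
qed

lemma dynamical_systemD:
  assumes "dynamical_system X T"
  shows "compact X" "continuous_on X (T ^^ n)"
  using assms continuous_on_funpow[of X T n] by (auto simp: dynamical_system_def)

lemma openin_preimage_dist_funpow: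
  assumes "dynamical_system X T" "open S"
  shows "openin (top_of_set X) {y \<in> X. dist a ((T ^^ n) y) \<in> S}"
proof -
  have "continuous_on X (\<lambda>y. dist a ((T ^^ n) y))"
    using dynamical_systemD(2)[OF assms(1)] by (intro continuous_intros)
  then have "openin (top_of_set X) (X \<inter> (\<lambda>y. dist a ((T ^^ n) y)) -` S)"
    using assms(2) by (rule continuous_openin_preimage_gen)
  then show ?thesis
    by (simp add: vimage_def Int_def)
qed

section \<open>Late separation times\<close>

text \<open>
  Equicontinuity of finitely many iterates at one point; it rules out the first \<open>N\<close> times as
  sensitivity times.
\<close>

lemma shrink_avoiding_early_times:
  assumes "dynamical_system X T" "opene X U" "\<delta> > 0"
  shows "\<exists>V\<subseteq>U. opene X V \<and> (\<forall>n\<le>N. n \<notin> sensitivity_times T V \<delta>)"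
proof -
  obtain x where x: "x \<in> U" and U: "openin (top_of_set X) U"
    using assms(2) by (auto simp: opene_def)
  have "x \<in> X"
    using x openin_imp_subset[OF U] by blast
  define W where "W n = {y \<in> X. dist ((T ^^ n) x) ((T ^^ n) y) \<in> {..<\<delta>/2}}" for n
  define V where "V = U \<inter> (\<Inter>n\<in>{..N}. W n)"
  have "openin (top_of_set X) (\<Inter>n\<in>{..N}. W n)"
    unfolding W_def
    by (intro openin_INT2 openin_preimage_dist_funpow[OF assms(1)]) auto
  then have "openin (top_of_set X) V"
    unfolding V_def using U by (intro openin_Int)
  moreover have "x \<in> V"
    using x \<open>x \<in> X\<close> \<open>\<delta> > 0\<close> by (auto simp: V_def W_def)
  moreover have "n \<notin> sensitivity_times T V \<delta>" if "n \<le> N" for n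
  proof -
    have "dist ((T ^^ n) y) ((T ^^ n) z) \<le> \<delta>" if "y \<in> V" "z \<in> V" for y z
    proof -
      have "dist ((T ^^ n) x) ((T ^^ n) y) < \<delta>/2" "dist ((T ^^ n) x) ((T ^^ n) z) < \<delta>/2"
        using that \<open>n \<le> N\<close> by (auto simp: V_def W_def)
      then show ?thesis
        using dist_triangle3[of "(T ^^ n) y" "(T ^^ n) z" "(T ^^ n) x"] by linarith
    qed
    then show ?thesis
      by (fastforce simp: sensitivity_times_def)
  qed
  ultimately show ?thesis
    by (intro exI[of _ V]) (auto simp: V_def opene_def)
qed

lemma sensitivity_time_separates:
  assumes "n \<in> sensitivity_times T U \<delta>"
  shows "\<exists>y\<in>U. dist ((T ^^ n) x) ((T ^^ n) y) > \<delta>/2"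
proof -
  obtain u v where uv: "u \<in> U" "v \<in> U" "dist ((T ^^ n) u) ((T ^^ n) v) > \<delta>"
    using assms by (auto simp: sensitivity_times_def)
  then have "dist ((T ^^ n) x) ((T ^^ n) u) > \<delta>/2 \<or> dist ((T ^^ n) x) ((T ^^ n) v) > \<delta>/2"
    using dist_triangle3[of "(T ^^ n) u" "(T ^^ n) v" "(T ^^ n) x"] by linarith
  then show ?thesis
    using uv by blast
qed

text \<open>
  Separation at one time is an open condition. The closure is taken in the ambient space, which
  agrees with the closure in \<open>X\<close> because \<open>X\<close> is compact.
\<close>

lemma separation_on_open_subset:
  assumes "dynamical_system X T" "opene X U" "u \<in> U" "dist a ((T ^^ n) u) > c"
  shows "\<exists>V. opene X V \<and> closure V \<subseteq> U \<and> (\<forall>y\<in>V. dist a ((T ^^ n) y) > c)"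
proof -
  have U: "openin (top_of_set X) U"
    using assms(2) by (simp add: opene_def)
  have "u \<in> X"
    using assms(3) openin_imp_subset[OF U] by blast
  define W where "W = U \<inter> {y \<in> X. dist a ((T ^^ n) y) \<in> {c<..}}"
  have "openin (top_of_set X) W"
    unfolding W_def by (intro openin_Int U openin_preimage_dist_funpow[OF assms(1)]) auto
  moreover have "u \<in> W"
    using assms(3,4) \<open>u \<in> X\<close> by (auto simp: W_def)
  ultimately obtain r where r: "r > 0" "cball u r \<inter> X \<subseteq> W"
    by (auto simp: openin_contains_cball)
  define V where "V = X \<inter> ball u r"
  have "closed X"
    using dynamical_systemD(1)[OF assms(1)] by (rule compact_imp_closed)
  then have "closure V \<subseteq> cball u r \<inter> X"
    unfolding V_def using ball_subset_cball[of u r] by (intro closure_minimal) auto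
  moreover have "V \<subseteq> cball u r \<inter> X"
    by (auto simp: V_def)
  moreover have "opene X V"
    using \<open>u \<in> X\<close> r(1) by (auto simp: V_def opene_def intro: centre_in_ball[THEN iffD2])
  ultimately show ?thesis
    using r(2) by (intro exI[of _ V]) (auto simp: W_def)
qed

text \<open>
  One step of the nested construction: all the sets can be separated from their reference points
  at a common time beyond any prescribed \<open>N\<close>.
\<close>

lemma later_separation:
  assumes ds: "dynamical_system X T" and "\<delta> > 0"
    and sens: "\<And>V. (\<forall>i\<in>I. opene X (V i)) \<Longrightarrow> (\<Inter>i\<in>I. sensitivity_times T (V i) \<delta>) \<noteq> {}"
    and "I \<noteq> {}" and U: "\<forall>i\<in>I. opene X (U i)"
  shows "\<exists>V. \<exists>n>N. \<forall>i\<in>I. opene X (V i) \<and> closure (V i) \<subseteq> U i \<and>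
           (\<forall>y\<in>V i. dist ((T ^^ n) (x i)) ((T ^^ n) y) > \<delta>/2)"
proof -
  have "\<forall>i\<in>I. \<exists>V\<subseteq>U i. opene X V \<and> (\<forall>n\<le>N. n \<notin> sensitivity_times T V \<delta>)"
    using U shrink_avoiding_early_times[OF ds _ \<open>\<delta> > 0\<close>] by blast
  then obtain W where W: "\<forall>i\<in>I. W i \<subseteq> U i \<and> opene X (W i) \<and>
      (\<forall>n\<le>N. n \<notin> sensitivity_times T (W i) \<delta>)"
    by metis
  then obtain n where n: "\<forall>i\<in>I. n \<in> sensitivity_times T (W i) \<delta>"
    using sens[of W] by blast
  have "n > N"
    using n W \<open>I \<noteq> {}\<close> by (meson ex_in_conv not_le)
  have "\<forall>i\<in>I. \<exists>V. opene X V \<and> closure V \<subseteq> U i \<and>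
          (\<forall>y\<in>V. dist ((T ^^ n) (x i)) ((T ^^ n) y) > \<delta>/2)"
  proof
    fix i assume i: "i \<in> I"
    obtain u where "u \<in> W i" "dist ((T ^^ n) (x i)) ((T ^^ n) u) > \<delta>/2"
      using sensitivity_time_separates n i by blast
    moreover have "opene X (W i)" "W i \<subseteq> U i"
      using W i by auto
    ultimately show "\<exists>V. opene X V \<and> closure V \<subseteq> U i \<and>
          (\<forall>y\<in>V. dist ((T ^^ n) (x i)) ((T ^^ n) y) > \<delta>/2)"
      using separation_on_open_subset[OF ds] by (meson order_trans)
  qed
  then show ?thesis
    using \<open>n > N\<close> by metis
qed

section \<open>Points separated infinitely often\<close>

lemma nested_closures_common_point:
  assumes "compact X"
    and V: "\<And>m. opene X (V m)" and nest: "\<And>m. closure (V (Suc m)) \<subseteq> V m"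
  shows "(\<Inter>m. V m) \<noteq> {}"
proof -
  have X: "V m \<subseteq> X" for m
    using V by (rule opene_subset)
  have "decseq V"
    using nest closure_subset by (intro decseq_SucI) blast
  have "X \<inter> (\<Inter>m\<in>UNIV. closure (V m)) \<noteq> {}"
  proof (rule compact_imp_fip_image[OF assms(1)])
    fix M :: "nat set" assume "finite M"
    then have "V (Max (insert 0 M)) \<subseteq> V m" if "m \<in> M" for m
      using \<open>decseq V\<close> that by (intro decseqD[of V]) (auto intro: Max_ge)
    moreover obtain z where "z \<in> V (Max (insert 0 M))"
      using V[of "Max (insert 0 M)"] by (auto simp: opene_def)
    ultimately show "X \<inter> (\<Inter>m\<in>M. closure (V m)) \<noteq> {}"
      using X closure_subset by blast
  qed auto
  then show ?thesis
    using nest by blast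
qed

text \<open>
  The sets and times of \<open>later_separation\<close> are chosen together by dependent choice, and the
  nested sets for each index can then be intersected separately, because the times are already
  common to all indices.
\<close>

lemma infinitely_many_separations:
  assumes ds: "dynamical_system X T" and "\<delta> > 0"
    and sens: "\<And>V. (\<forall>i\<in>I. opene X (V i)) \<Longrightarrow> (\<Inter>i\<in>I. sensitivity_times T (V i) \<delta>) \<noteq> {}"
    and "I \<noteq> {}" and U: "\<forall>i\<in>I. opene X (U i)"
  shows "\<exists>y r. strict_mono (r :: nat \<Rightarrow> nat) \<and>
           (\<forall>i\<in>I. y i \<in> U i \<and> (\<forall>m. dist ((T ^^ r m) (x i)) ((T ^^ r m) (y i)) > \<delta>/2))"
proof -
  define P where "P p \<longleftrightarrow> (\<forall>i\<in>I. opene X (fst p i))" for p :: "('b \<Rightarrow> 'a set) \<times> nat"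
  define Q where "Q p q \<longleftrightarrow> snd p < snd q \<and> (\<forall>i\<in>I. closure (fst q i) \<subseteq> fst p i \<and>
      (\<forall>y\<in>fst q i. dist ((T ^^ snd q) (x i)) ((T ^^ snd q) y) > \<delta>/2))"
    for p q :: "('b \<Rightarrow> 'a set) \<times> nat"
  have step: "\<exists>q. P q \<and> Q p q" if "P p" for p
    using later_separation[OF ds \<open>\<delta> > 0\<close> sens \<open>I \<noteq> {}\<close>, of "fst p" "snd p" x] that
    by (fastforce simp: P_def Q_def)
  have "\<exists>f. \<forall>m. (P (f m) \<and> (m = 0 \<longrightarrow> f m = (U, 0))) \<and> Q (f m) (f (Suc m))"
  proof (rule dependent_nat_choice)
    show "\<exists>p. P p \<and> (0 = (0::nat) \<longrightarrow> p = (U, 0))"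
      using U by (auto simp: P_def)
  next
    fix p and m :: nat
    assume "P p \<and> (m = 0 \<longrightarrow> p = (U, 0))"
    then show "\<exists>q. (P q \<and> (Suc m = 0 \<longrightarrow> q = (U, 0))) \<and> Q p q"
      using step[of p] by auto
  qed
  then obtain f where f: "\<And>m. P (f m)" "f 0 = (U, 0)" "\<And>m. Q (f m) (f (Suc m))"
    by blast
  have "\<forall>i\<in>I. \<exists>z. \<forall>m. z \<in> fst (f m) i"
  proof
    fix i assume "i \<in> I"
    then have "(\<Inter>m. fst (f m) i) \<noteq> {}"
      using f(1,3) dynamical_systemD(1)[OF ds]
      by (intro nested_closures_common_point[of X]) (auto simp: P_def Q_def)
    then show "\<exists>z. \<forall>m. z \<in> fst (f m) i"
      by blast
  qed
  then obtain y where y: "\<And>i m. i \<in> I \<Longrightarrow> y i \<in> fst (f m) i"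
    by metis
  \<comment> \<open>The initial pair \<open>(U, 0)\<close> carries no separation, so the times start with the first step.\<close>
  define r where "r m = snd (f (Suc m))" for m
  have "strict_mono r"
    using f(3) by (auto simp: strict_mono_Suc_iff r_def Q_def)
  moreover have "y i \<in> U i" if "i \<in> I" for i
    using y[OF that, of 0] f(2) by simp
  moreover have "dist ((T ^^ r m) (x i)) ((T ^^ r m) (y i)) > \<delta>/2" if "i \<in> I" for i m
    using y[OF that, of "Suc m"] f(3)[of m] that by (auto simp: Q_def r_def)
  ultimately show ?thesis
    by blast
qed

section \<open>Limits superior and the equivalence\<close>

lemma less_limsup_if_subseq_ge:
  fixes g :: "nat \<Rightarrow> real" and r :: "nat \<Rightarrow> nat"
  assumes "strict_mono r" "\<And>m. c \<le> g (r m)" "d < c"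
  shows "ereal d < limsup (\<lambda>n. ereal (g n))"
proof -
  have "ereal d < ereal c"
    using assms(3) by simp
  also have "ereal c \<le> limsup ((\<lambda>n. ereal (g n)) \<circ> r)"
    using assms(2) by (intro le_Limsup) auto
  also have "\<dots> \<le> limsup (\<lambda>n. ereal (g n))"
    using assms(1) by (rule limsup_subseq_mono)
  finally show ?thesis .
qed

lemma exceeds_if_less_limsup:
  fixes g :: "nat \<Rightarrow> real"
  assumes "ereal d < limsup (\<lambda>n. ereal (g n))"
  shows "\<exists>n. d < g n"
proof (rule ccontr)
  assume "\<nexists>n. d < g n"
  then have "limsup (\<lambda>n. ereal (g n)) \<le> ereal d"
    by (intro Limsup_bounded) (auto simp: not_less)
  then show False
    using assms by simp
qed

theorem proposition5p2:
  fixes X :: "'a::metric_space set" and T :: "'a \<Rightarrow> 'a"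
  assumes "dynamical_system X T"
  defines "C1 \<equiv> multi_sensitive X T"
    and "C2 \<equiv> (\<exists>\<delta>::real. \<delta> > 0 \<and> (\<forall>k::nat. k \<ge> 1 \<longrightarrow> (\<forall>x U.
          (\<forall>i\<in>{1..k}. x i \<in> X \<and> openin (top_of_set X) (U i) \<and> x i \<in> U i) \<longrightarrow>
          (\<exists>y n. (\<forall>i\<in>{1..k}. y i \<in> U i) \<and>
             (MIN i\<in>{1..k}. dist ((T ^^ n) (x i)) ((T ^^ n) (y i))) > \<delta>))))"
    and "C3 \<equiv> (\<exists>\<delta>::real. \<delta> > 0 \<and> (\<forall>k::nat. k \<ge> 1 \<longrightarrow> (\<forall>x U.
          (\<forall>i\<in>{1..k}. x i \<in> X \<and> openin (top_of_set X) (U i) \<and> x i \<in> U i) \<longrightarrow>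
          (\<exists>y. (\<forall>i\<in>{1..k}. y i \<in> U i) \<and>
             limsup (\<lambda>n. ereal (MIN i\<in>{1..k}. dist ((T ^^ n) (x i)) ((T ^^ n) (y i)))) > ereal \<delta>))))"
    and "C4 \<equiv> (\<exists>\<delta>::real. \<delta> > 0 \<and> (\<forall>k::nat. k \<ge> 1 \<longrightarrow> (\<forall>U.
          (\<forall>i\<in>{1..k}. opene X (U i)) \<longrightarrow>
          (\<exists>x y. (\<forall>i\<in>{1..k}. x i \<in> U i \<and> y i \<in> U i) \<and>
             limsup (\<lambda>n. ereal (MIN i\<in>{1..k}. dist ((T ^^ n) (x i)) ((T ^^ n) (y i)))) > ereal \<delta>))))"
  shows "(C1 \<longleftrightarrow> C2) \<and> (C2 \<longleftrightarrow> C3) \<and> (C3 \<longleftrightarrow> C4)"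
proof -
  note ds = assms(1)
  have Min_greater: "c < (MIN i\<in>{1..k}. h i) \<longleftrightarrow> (\<forall>i\<in>{1..k}. c < h i)"
    if "k \<ge> 1" for k :: nat and h :: "nat \<Rightarrow> real" and c
    using that by (subst Min_gr_iff) auto
  have "C1 \<Longrightarrow> C3"
  proof -
    assume C1
    then obtain \<delta> where "\<delta> > 0" and sens: "\<And>k V. k \<ge> 1 \<Longrightarrow> \<forall>i\<in>{1..k}. opene X (V i) \<Longrightarrow>
        (\<Inter>i\<in>{1..k::nat}. sensitivity_times T (V i) \<delta>) \<noteq> {}"
      unfolding C1_def multi_sensitive_def by blast
    \<comment> \<open>The constant is halved once for fixing the points \<open>x\<^sub>i\<close>, and again because a limit
      superior of values above \<open>\<delta>/2\<close> may equal \<open>\<delta>/2\<close>.\<close>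
    show C3
      unfolding C3_def
    proof (intro exI[of _ "\<delta>/4"] conjI allI impI)
      fix k :: nat and x :: "nat \<Rightarrow> 'a" and U
      assume k: "k \<ge> 1"
        and U: "\<forall>i\<in>{1..k}. x i \<in> X \<and> openin (top_of_set X) (U i) \<and> x i \<in> U i"
      have "\<forall>i\<in>{1..k}. opene X (U i)"
        using U by (auto simp: opene_def)
      then obtain y r where r: "strict_mono (r :: nat \<Rightarrow> nat)"
        and y: "\<forall>i\<in>{1..k}. y i \<in> U i \<and> (\<forall>m. dist ((T ^^ r m) (x i)) ((T ^^ r m) (y i)) > \<delta>/2)"
        using infinitely_many_separations[OF ds \<open>\<delta> > 0\<close> sens[OF k], of U x] k by auto
      have "limsup (\<lambda>n. ereal (MIN i\<in>{1..k}. dist ((T ^^ n) (x i)) ((T ^^ n) (y i)))) > ereal (\<delta>/4)"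
      proof (rule less_limsup_if_subseq_ge[OF r])
        show "\<delta>/2 \<le> (MIN i\<in>{1..k}. dist ((T ^^ r m) (x i)) ((T ^^ r m) (y i)))" for m
          using y by (intro less_imp_le) (subst Min_greater[OF k], blast)
        show "\<delta>/4 < \<delta>/2"
          using \<open>\<delta> > 0\<close> by simp
      qed
      then show "\<exists>y. (\<forall>i\<in>{1..k}. y i \<in> U i) \<and>
          limsup (\<lambda>n. ereal (MIN i\<in>{1..k}. dist ((T ^^ n) (x i)) ((T ^^ n) (y i)))) > ereal (\<delta>/4)"
        using y by blast
    qed (use \<open>\<delta> > 0\<close> in simp)
  qed
  moreover have "C3 \<Longrightarrow> C2"
  proof -
    assume C3
    then obtain \<delta> where "\<delta> > 0" and sep: "\<forall>k::nat. k \<ge> 1 \<longrightarrow> (\<forall>x U.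
        (\<forall>i\<in>{1..k}. x i \<in> X \<and> openin (top_of_set X) (U i) \<and> x i \<in> U i) \<longrightarrow>
        (\<exists>y. (\<forall>i\<in>{1..k}. y i \<in> U i) \<and>
          limsup (\<lambda>n. ereal (MIN i\<in>{1..k}. dist ((T ^^ n) (x i)) ((T ^^ n) (y i)))) > ereal \<delta>))"
      unfolding C3_def by - (elim exE conjE, rule that)
    show C2
      unfolding C2_def
    proof (intro exI[of _ \<delta>] conjI allI impI)
      fix k :: nat and x :: "nat \<Rightarrow> 'a" and U
      assume k: "k \<ge> 1"
        and xU: "\<forall>i\<in>{1..k}. x i \<in> X \<and> openin (top_of_set X) (U i) \<and> x i \<in> U i"
      from sep[THEN spec, THEN mp, OF k, THEN spec, THEN spec, THEN mp, OF xU]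
      obtain y where y: "\<forall>i\<in>{1..k}. y i \<in> U i"
        and "limsup (\<lambda>n. ereal (MIN i\<in>{1..k}. dist ((T ^^ n) (x i)) ((T ^^ n) (y i)))) > ereal \<delta>"
        by blast
      from exceeds_if_less_limsup[OF this(2)]
      obtain n where "(MIN i\<in>{1..k}. dist ((T ^^ n) (x i)) ((T ^^ n) (y i))) > \<delta>"
        by (rule exE)
      with y show "\<exists>y n. (\<forall>i\<in>{1..k}. y i \<in> U i) \<and>
          (MIN i\<in>{1..k}. dist ((T ^^ n) (x i)) ((T ^^ n) (y i))) > \<delta>"
        by (intro exI conjI)
    qed fact
  qed
  moreover have "C2 \<Longrightarrow> C1"
  proof -
    assume C2
    then obtain \<delta> where "\<delta> > 0" and sep: "\<forall>k::nat. k \<ge> 1 \<longrightarrow> (\<forall>x U.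
        (\<forall>i\<in>{1..k}. x i \<in> X \<and> openin (top_of_set X) (U i) \<and> x i \<in> U i) \<longrightarrow>
        (\<exists>y n. (\<forall>i\<in>{1..k}. y i \<in> U i) \<and>
          (MIN i\<in>{1..k}. dist ((T ^^ n) (x i)) ((T ^^ n) (y i))) > \<delta>))"
      unfolding C2_def by - (elim exE conjE, rule that)
    show C1
      unfolding C1_def multi_sensitive_def
    proof (intro exI[of _ \<delta>] conjI allI impI)
      fix k :: nat and U
      assume k: "k \<ge> 1" and U: "\<forall>i\<in>{1..k}. opene X (U i)"
      obtain x
        where x: "\<forall>i\<in>{1..k}. x i \<in> X \<and> openin (top_of_set X) (U i) \<and> x i \<in> U i"
        using opene_selection[OF U] by (rule exE)
      from sep[THEN spec, THEN mp, OF k, THEN spec, THEN spec, THEN mp, OF x]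
      obtain y n where "\<forall>i\<in>{1..k}. y i \<in> U i"
        and "(MIN i\<in>{1..k}. dist ((T ^^ n) (x i)) ((T ^^ n) (y i))) > \<delta>"
        by blast
      then have "\<forall>i\<in>{1..k}. n \<in> sensitivity_times T (U i) \<delta>"
        using x unfolding Min_greater[OF k] sensitivity_times_def by blast
      then show "(\<Inter>i\<in>{1..k}. sensitivity_times T (U i) \<delta>) \<noteq> {}"
        by blast
    qed fact
  qed
  moreover have "C3 \<Longrightarrow> C4"
  proof -
    assume C3
    then obtain \<delta> where "\<delta> > 0" and sep: "\<forall>k::nat. k \<ge> 1 \<longrightarrow> (\<forall>x U.
        (\<forall>i\<in>{1..k}. x i \<in> X \<and> openin (top_of_set X) (U i) \<and> x i \<in> U i) \<longrightarrow>
        (\<exists>y. (\<forall>i\<in>{1..k}. y i \<in> U i) \<and>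
          limsup (\<lambda>n. ereal (MIN i\<in>{1..k}. dist ((T ^^ n) (x i)) ((T ^^ n) (y i)))) > ereal \<delta>))"
      unfolding C3_def by - (elim exE conjE, rule that)
    show C4
      unfolding C4_def
    proof (intro exI[of _ \<delta>] conjI allI impI)
      fix k :: nat and U
      assume k: "k \<ge> 1" and U: "\<forall>i\<in>{1..k}. opene X (U i)"
      obtain x
        where x: "\<forall>i\<in>{1..k}. x i \<in> X \<and> openin (top_of_set X) (U i) \<and> x i \<in> U i"
        using opene_selection[OF U] by (rule exE)
      from sep[THEN spec, THEN mp, OF k, THEN spec, THEN spec, THEN mp, OF x] x
      show "\<exists>x y. (\<forall>i\<in>{1..k}. x i \<in> U i \<and> y i \<in> U i) \<and>
          limsup (\<lambda>n. ereal (MIN i\<in>{1..k}. dist ((T ^^ n) (x i)) ((T ^^ n) (y i)))) > ereal \<delta>"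
        by blast
    qed fact
  qed
  moreover have "C4 \<Longrightarrow> C1"
  proof -
    assume C4
    then obtain \<delta> where "\<delta> > 0" and sep: "\<forall>k::nat. k \<ge> 1 \<longrightarrow> (\<forall>U.
        (\<forall>i\<in>{1..k}. opene X (U i)) \<longrightarrow>
        (\<exists>x y. (\<forall>i\<in>{1..k}. x i \<in> U i \<and> y i \<in> U i) \<and>
          limsup (\<lambda>n. ereal (MIN i\<in>{1..k}. dist ((T ^^ n) (x i)) ((T ^^ n) (y i)))) > ereal \<delta>))"
      unfolding C4_def by - (elim exE conjE, rule that)
    show C1
      unfolding C1_def multi_sensitive_def
    proof (intro exI[of _ \<delta>] conjI allI impI)
      fix k :: nat and U
      assume k: "k \<ge> 1" and U: "\<forall>i\<in>{1..k}. opene X (U i)"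
      from sep[THEN spec, THEN mp, OF k, THEN spec, THEN mp, OF U]
      obtain x y where xy: "\<forall>i\<in>{1..k}. x i \<in> U i \<and> y i \<in> U i"
        and "limsup (\<lambda>n. ereal (MIN i\<in>{1..k}. dist ((T ^^ n) (x i)) ((T ^^ n) (y i)))) > ereal \<delta>"
        by blast
      from exceeds_if_less_limsup[OF this(2)]
      obtain n where "(MIN i\<in>{1..k}. dist ((T ^^ n) (x i)) ((T ^^ n) (y i))) > \<delta>"
        by (rule exE)
      then have "\<forall>i\<in>{1..k}. n \<in> sensitivity_times T (U i) \<delta>"
        using xy unfolding Min_greater[OF k] sensitivity_times_def by blast
      then show "(\<Inter>i\<in>{1..k}. sensitivity_times T (U i) \<delta>) \<noteq> {}"
        by blast
    qed fact
  qed
  ultimately show ?thesis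
    by blast
qed

end
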